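(* Let $\kappa = 2m\pi/L$ for some integer $m$, and let $w^\star(x,t)$ be the exact solution of the periodic advection problem $$w_t+\lambda w_x=0 \ \text{ on } [0,L]\times[0,T],\qquad w(0,t)=w(L,t)\ \text{ for } t\in[0,T],\qquad w(x,0)=w_0(x)\ \text{ for } x\in[0,L],$$ with simple wave initial condition $w_0(x)=e^{i\kappa x}$. For a positive integer $N$ and $h=L/N$, let $w_j(t)$ and $\overline{w}_{j+1/2}(t)$ solve the semi-discretized hybrid-variable ODE system $$\overline{w}_{j+1/2}'+\frac{\lambda}{h}(w_{j+1}-w_j)=0,\qquad w_j'+\frac{\lambda}{h}\left(w_{j-1}-\frac72\overline{w}_{j-1/2}+2w_j+\frac12\overline{w}_{j+1/2}\right)=0,\qquad \forall j,\ t\in[0,T],$$ with exact initial data $$w_j(0)=w^\star(x_j,0),\qquad \overline{w}_{j+1/2}(0)=\frac1h\int_{x_j}^{x_{j+1}}w^\star(x,0)\,dx .$$ Then $$|w_j(T)-w^\star(x_j,T)|\le Ch^4\quad\text{and}\quad \left|\overline{w}_{j+1/2}(T)-\frac1h\int_{x_j}^{x_{j+1}}w^\star(x,T)\,dx\right|\le Ch^4,\qquad\forall j,$$ where $C$ is a constant that depends only on $L$, $T$, $\lambda$, and $\kappa$ (in particular, not on $N$ or $j$).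
   Context: Here $L>0$, $T>0$, and $\lambda>0$ is a constant advection velocity. The interval $[0,L]$ is divided into $N$ uniform cells $[x_j,x_{j+1}]$, $0\le j\le N-1$, with $x_j=jh$ and $h=L/N$. The unknowns are the nodal values $w_j(t)$ and the cell-averaged values $\overline{w}_{j+1/2}(t)$ (complex-valued functions of $t$), with the periodic index convention $w_j=w_{j+N}$ and $\overline{w}_{j+1/2}=\overline{w}_{j+N+1/2}$. *)

theory Defs
  imports "HOL-Analysis.Analysis"
begin

(* Classical solutions. Derivatives are taken within the closed rectangle, hence one-sided on its
   boundary. Joint differentiability is what makes the solution unique (it is constant along
   characteristics); mere existence of the two partial derivatives would not be an adequate notion
   of solution, and continuity of the partial derivatives is not required. *)
definition periodic_advection_solution ::
  "real \<Rightarrow> real \<Rightarrow> real \<Rightarrow> (real \<Rightarrow> complex) \<Rightarrow> (real \<Rightarrow> real \<Rightarrow> complex) \<Rightarrow> bool" where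
  "periodic_advection_solution L T lam w0 w \<longleftrightarrow>
     (\<lambda>(x, t). w x t) differentiable_on ({0..L} \<times> {0..T}) \<and>
     (\<forall>x\<in>{0..L}. \<forall>t\<in>{0..T}. \<exists>wt wx.
        ((\<lambda>s. w x s) has_vector_derivative wt) (at t within {0..T}) \<and>
        ((\<lambda>y. w y t) has_vector_derivative wx) (at x within {0..L}) \<and>
        wt + of_real lam * wx = 0) \<and>
     (\<forall>t\<in>{0..T}. w 0 t = w L t) \<and>
     (\<forall>x\<in>{0..L}. w x 0 = w0 x)"

definition mesh :: "real \<Rightarrow> nat \<Rightarrow> real" where
  "mesh L N = L / real N"

definition node :: "real \<Rightarrow> nat \<Rightarrow> int \<Rightarrow> real" where
  "node L N j = of_int j * mesh L N"

definition cell_average :: "real \<Rightarrow> nat \<Rightarrow> int \<Rightarrow> (real \<Rightarrow> complex) \<Rightarrow> complex" where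
  "cell_average L N j f =
     of_real (1 / mesh L N) * integral {node L N j..node L N (j + 1)} f"

(* Unknowns are indexed by all integers subject to N-periodicity; wbar j is the average over
   the cell [x_j, x_(j+1)], i.e. the unknown with half-integer index j + 1/2. *)
definition hybrid_variable_solution ::
  "real \<Rightarrow> real \<Rightarrow> real \<Rightarrow> nat \<Rightarrow> (int \<Rightarrow> real \<Rightarrow> complex) \<Rightarrow> (int \<Rightarrow> real \<Rightarrow> complex) \<Rightarrow> bool" where
  "hybrid_variable_solution L T lam N w wbar \<longleftrightarrow>
     (\<forall>j. \<forall>t\<in>{0..T}. w (j + int N) t = w j t \<and> wbar (j + int N) t = wbar j t) \<and>
     (\<forall>j. \<forall>t\<in>{0..T}. \<exists>dwbar dw.
        (wbar j has_vector_derivative dwbar) (at t within {0..T}) \<and>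
        (w j has_vector_derivative dw) (at t within {0..T}) \<and>
        dwbar + of_real (lam / mesh L N) * (w (j + 1) t - w j t) = 0 \<and>
        dw + of_real (lam / mesh L N) *
          (w (j - 1) t - 7/2 * wbar (j - 1) t + 2 * w j t + 1/2 * wbar j t) = 0)"

(* Over one period the nodes are x_0, ..., x_N and the cells are numbered 0, ..., N - 1. *)
definition exact_initial_data ::
  "real \<Rightarrow> nat \<Rightarrow> (real \<Rightarrow> real \<Rightarrow> complex) \<Rightarrow> (int \<Rightarrow> real \<Rightarrow> complex) \<Rightarrow>
     (int \<Rightarrow> real \<Rightarrow> complex) \<Rightarrow> bool" where
  "exact_initial_data L N wstar w wbar \<longleftrightarrow>
     (\<forall>j\<in>{0..int N}. w j 0 = wstar (node L N j) 0) \<and>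
     (\<forall>j\<in>{0..<int N}. wbar j 0 = cell_average L N j (\<lambda>x. wstar x 0))"

end

theory Submission
  imports Defs
begin

text \<open>The exact solution is the travelling wave \<open>exp (\<i> \<kappa> (x - \<lambda> t))\<close>: a solution that is
  differentiable on the closed rectangle is constant along characteristics, and periodicity lets a
  characteristic that leaves the interval on the left re-enter on the right
  (\<open>advection_solution_eq\<close>).

  Put \<open>h = L / N\<close> and \<open>z = \<i> \<kappa> h\<close>. The initial data satisfy \<open>w\<^sub>j = exp (j z)\<close> and
  \<open>wbar\<^sub>j = exp (j z) \<phi>(z)\<close> with \<open>\<phi>(z) = (exp z - 1) / z\<close>. The semi-discrete system is linear and
  translation invariant, and an energy estimate shows that zero data give the zero solution; so the
  solution keeps the form \<open>exp (j z) a(t)\<close>, \<open>exp (j z) b(t)\<close> for all times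
  (\<open>hybrid_variable_single_mode\<close>). This leaves the system
  \<open>b' = - (\<lambda>/h) (exp z - 1) a\<close>,
  \<open>a' = - (\<lambda>/h) ((exp (-z) + 2) a + (1/2 - 7/2 exp (-z)) b)\<close>,
  to be compared with \<open>a = exp (- z \<lambda> t / h)\<close>, \<open>b = \<phi>(z) a\<close>.

  The truncation error of the second equation is only \<open>O(h\<^sup>3)\<close>. The fourth order comes from the
  spectrum of the coefficient matrix. If \<open>p\<close> is its characteristic polynomial, then
  \<open>p(z) = O(z\<^sup>5)\<close> by Taylor expansion (\<open>symbol_defect_bound\<close>). One eigenvalue is therefore
  \<open>m1 = z + O(z\<^sup>5)\<close>, which gives a phase error \<open>(\<lambda> T / h) O(h\<^sup>5) = O(h\<^sup>4)\<close>, while the other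
  is \<open>m2 = exp (-z) + 2 - m1\<close>, which has positive real part for small \<open>z\<close>, so that its mode is
  damped. The component of the exact wave in the damped mode is \<open>O(z\<^sup>4)\<close>. Diagonalising with left
  eigenvectors turns these facts into the estimate \<open>resolved_mode_error\<close> for \<open>\<bar>z\<bar> \<le> 1/2\<close>.
  On coarser meshes \<open>h\<close> is bounded below by \<open>1 / (2 \<bar>\<kappa>\<bar>)\<close>, and the energy estimate bounds the
  error by a constant, hence by a constant times \<open>h\<^sup>4\<close>.\<close>

section \<open>Linear differential equations and growth bounds\<close>

lemma linear_ode_solution:
  fixes u :: "real \<Rightarrow> complex"
  assumes T: "0 \<le> T"
    and ode: "\<And>t. t \<in> {0..T} \<Longrightarrow> (u has_vector_derivative - c * u t) (at t within {0..T})"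
    and t: "t \<in> {0..T}"
  shows "u t = exp (- c * of_real t) * u 0"
proof -
  have d: "((\<lambda>t. exp (c * of_real t) * u t) has_vector_derivative 0) (at t within {0..T})"
    if "t \<in> {0..T}" for t
  proof -
    have "((\<lambda>z. exp (c * z)) has_field_derivative c * exp (c * of_real t)) (at (of_real t))"
      by (auto intro!: derivative_eq_intros)
    then have "((\<lambda>t. exp (c * of_real t)) has_vector_derivative c * exp (c * of_real t)) (at t within {0..T})"
      by (rule has_vector_derivative_real_field)
    from has_vector_derivative_mult[OF this ode[OF that]] show ?thesis
      by (simp add: algebra_simps)
  qed
  obtain k where k: "\<forall>t\<in>{0..T}. exp (c * of_real t) * u t = k"
    using d has_derivative_zero_constant[of "{0..T}" "\<lambda>t. exp (c * of_real t) * u t"]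
    by (auto simp: has_vector_derivative_def)
  then have "exp (c * of_real t) * u t = exp (c * of_real 0) * u 0"
    using bspec[OF k t] bspec[OF k, of 0] T by simp
  then show ?thesis by (simp add: exp_minus field_simps)
qed

lemma exponential_growth_bound:
  fixes E E' :: "real \<Rightarrow> real"
  assumes T: "0 \<le> T"
    and der: "\<And>t. t \<in> {0..T} \<Longrightarrow> (E has_vector_derivative E' t) (at t within {0..T})"
    and le: "\<And>t. t \<in> {0..T} \<Longrightarrow> E' t \<le> K * E t"
    and t: "t \<in> {0..T}"
  shows "E t \<le> exp (K * t) * E 0"
proof -
  have d: "((\<lambda>t. exp (- K * t) * E t) has_derivative (\<lambda>y. y * (exp (- K * s) * (E' s - K * E s)))) (at s within {0..t})"
    if "0 \<le> s" "s \<le> t" for s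
  proof -
    have "(E has_vector_derivative E' s) (at s within {0..t})"
      using t that by (intro has_vector_derivative_within_subset[OF der]) auto
    moreover have "((\<lambda>t. exp (- K * t)) has_vector_derivative - K * exp (- K * s)) (at s within {0..t})"
      unfolding has_real_derivative_iff_has_vector_derivative[symmetric]
      by (auto intro!: derivative_eq_intros)
    ultimately have "((\<lambda>t. exp (- K * t) * E t) has_vector_derivative
        exp (- K * s) * (E' s - K * E s)) (at s within {0..t})"
      by (auto intro!: has_vector_derivative_eq_rhs[OF has_vector_derivative_mult] simp: algebra_simps)
    then show ?thesis by (simp add: has_vector_derivative_def)
  qed
  obtain s where s: "s \<in> {0..t}"
    and eq: "exp (- K * t) * E t - exp (- K * 0) * E 0 = (t - 0) * (exp (- K * s) * (E' s - K * E s))"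
    using mvt_very_simple[OF _ d] t by fastforce
  have "(t - 0) * (exp (- K * s) * (E' s - K * E s)) \<le> 0"
    using le[of s] s t by (intro mult_nonneg_nonpos) auto
  with eq have "exp (- K * t) * E t \<le> E 0" by simp
  then have "exp (K * t) * (exp (- K * t) * E t) \<le> exp (K * t) * E 0" by simp
  then show ?thesis by (simp add: mult.assoc[symmetric] exp_add[symmetric])
qed

section \<open>The exact solution\<close>

text \<open>On the closed rectangle the derivative of the solution annihilates the direction
  \<open>(\<lambda>, 1)\<close>, so the solution is constant along \<open>s \<mapsto> (x - \<lambda> (t - s), s)\<close>. The proof is by induction
  on a bound \<open>n\<close> for the number of times the characteristic through \<open>(x, t)\<close>, traced back to time 0, crosses
  the boundary point 0 and continues from \<open>L\<close>.\<close>

lemma advection_solution_eq: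
  fixes L T lam kappa :: real
  assumes L: "L > 0" and T: "T > 0" and lam: "lam > 0"
    and kappa: "kappa = 2 * of_int m * pi / L"
    and sol: "periodic_advection_solution L T lam (\<lambda>x. exp (\<i> * of_real (kappa * x))) w"
    and x: "x \<in> {0..L}" and t: "t \<in> {0..T}"
  shows "w x t = exp (\<i> * of_real (kappa * (x - lam * t)))"
proof -
  let ?R = "{0..L} \<times> {0..T}"
  define W where "W = (\<lambda>(x, t). w x t)"
  have diff: "W differentiable_on ?R"
    and pde: "\<And>x t. x \<in> {0..L} \<Longrightarrow> t \<in> {0..T} \<Longrightarrow> \<exists>wt wx.
        ((\<lambda>s. w x s) has_vector_derivative wt) (at t within {0..T}) \<and>
        ((\<lambda>y. w y t) has_vector_derivative wx) (at x within {0..L}) \<and>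
        wt + of_real lam * wx = 0"
    and per: "\<And>t. t \<in> {0..T} \<Longrightarrow> w 0 t = w L t"
    and init: "\<And>x. x \<in> {0..L} \<Longrightarrow> w x 0 = exp (\<i> * of_real (kappa * x))"
    using sol by (auto simp: periodic_advection_solution_def W_def)
  have der0: "(W has_derivative D) (at (x, t) within ?R) \<Longrightarrow> D (lam, 1) = 0"
    if x: "x \<in> {0..L}" and t: "t \<in> {0..T}" for x t D
  proof -
    assume D: "(W has_derivative D) (at (x, t) within ?R)"
    obtain wt wx where wt: "((\<lambda>s. w x s) has_vector_derivative wt) (at t within {0..T})"
      and wx: "((\<lambda>y. w y t) has_vector_derivative wx) (at x within {0..L})"
      and eq: "wt + of_real lam * wx = 0"
      using pde[OF x t] by blast
    have "((\<lambda>s. (x, s)) has_vector_derivative (0, 1)) (at t within {0..T})"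
      by (auto intro!: derivative_eq_intros)
    then have "(W \<circ> (\<lambda>s. (x, s)) has_vector_derivative D (0, 1)) (at t within {0..T})"
      by (rule vector_derivative_diff_chain_within) (rule has_derivative_subset[OF D], use x in auto)
    then have 1: "D (0, 1) = wt"
      using wt t T by (auto simp: W_def o_def intro: vector_derivative_unique_within_closed_interval)
    have "((\<lambda>y. (y, t)) has_vector_derivative (1, 0)) (at x within {0..L})"
      by (auto intro!: derivative_eq_intros)
    then have "(W \<circ> (\<lambda>y. (y, t)) has_vector_derivative D (1, 0)) (at x within {0..L})"
      by (rule vector_derivative_diff_chain_within) (rule has_derivative_subset[OF D], use t in auto)
    then have 2: "D (1, 0) = wx"
      using wx x L by (auto simp: W_def o_def intro: vector_derivative_unique_within_closed_interval)
    interpret D: bounded_linear D using D by (rule has_derivative_bounded_linear)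
    have "D (lam, 1) = D (lam *\<^sub>R (1, 0) + (0, 1))" by simp
    also have "\<dots> = lam *\<^sub>R D (1, 0) + D (0, 1)" by (simp only: D.add D.scaleR)
    finally show ?thesis using 1 2 eq by (simp add: scaleR_conv_of_real add.commute)
  qed
  have char: "w x t = w (x - lam * (t - s)) s"
    if x: "x \<in> {0..L}" and t: "t \<in> {0..T}" and s: "s \<in> {0..t}" and ge: "x - lam * (t - s) \<ge> 0" for x t s
  proof -
    define g where "g = (\<lambda>r. (x - lam * (t - r), r))"
    have gR: "g ` {s..t} \<subseteq> ?R"
    proof
      fix y assume "y \<in> g ` {s..t}"
      then obtain r where r: "r \<in> {s..t}" "y = (x - lam * (t - r), r)" by (auto simp: g_def)
      have "lam * (t - r) \<le> lam * (t - s)" "lam * (t - r) \<ge> 0" using r lam by auto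
      then show "y \<in> ?R" using r x t s ge by auto
    qed
    have "(W \<circ> g has_vector_derivative 0) (at r within {s..t})" if r: "r \<in> {s..t}" for r
    proof -
      have gr: "g r \<in> ?R" using gR r by blast
      then obtain D where D: "(W has_derivative D) (at (g r) within ?R)"
        using bspec[OF diff[unfolded differentiable_on_def] gr] unfolding differentiable_def by (elim exE)
      have g': "(g has_vector_derivative (lam, 1)) (at r within {s..t})"
        unfolding g_def by (auto intro!: derivative_eq_intros)
      have "(W \<circ> g has_vector_derivative D (lam, 1)) (at r within {s..t})"
        by (rule vector_derivative_diff_chain_within[OF g']) (rule has_derivative_subset[OF D gR])
      then show ?thesis
        using der0[of "fst (g r)" "snd (g r)" D] D gr by (auto simp: mem_Times_iff)
    qed
    then have "\<exists>k. \<forall>r\<in>{s..t}. (W \<circ> g) r = k"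
      by (intro has_derivative_zero_constant convex_real_interval)
         (simp add: has_vector_derivative_def o_def)
    then have "(W \<circ> g) s = (W \<circ> g) t" using s by (metis atLeastAtMost_iff order_refl)
    then show ?thesis by (simp add: W_def g_def)
  qed
  have wraps: "w x t = exp (\<i> * of_real (kappa * (x - lam * t)))"
    if "x \<in> {0..L}" "t \<in> {0..T}" "x - lam * t \<ge> - real n * L" for n x t
    using that
  proof (induction n arbitrary: x t)
    case 0
    then have "w x t = w (x - lam * t) 0" using char[of x t 0] by auto
    also have "\<dots> = exp (\<i> * of_real (kappa * (x - lam * t)))"
    proof (rule init)
      have "lam * t \<ge> 0" using lam 0 by auto
      then show "x - lam * t \<in> {0..L}" using 0 by auto
    qed
    finally show ?case .
  next
    case (Suc n)
    show ?case
    proof (cases "x - lam * t \<ge> - real n * L")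
      case True
      then show ?thesis using Suc by blast
    next
      case False
      then have neg: "x - lam * t < 0" using L
        by (smt (verit) mult_nonneg_nonneg mult_minus_left of_nat_0_le_iff)
      \<comment> \<open>the time at which the characteristic through \<open>(x, t)\<close> meets the left boundary\<close>
      define s where "s = t - x / lam"
      have s: "s \<in> {0..t}" using neg lam Suc.prems by (auto simp: s_def field_simps)
      have xs: "x - lam * (t - s) = 0" using lam by (simp add: s_def)
      have "w x t = w 0 s" using char[of x t s] Suc.prems s xs by auto
      also have "\<dots> = w L s" using per s Suc.prems by auto
      also have "\<dots> = exp (\<i> * of_real (kappa * (L - lam * s)))"
      proof (rule Suc.IH)
        have "lam * s = lam * t - x" using lam by (simp add: s_def field_simps)
        then show "L - lam * s \<ge> - real n * L" using Suc.prems by (simp add: algebra_simps)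
      qed (use Suc.prems s L in auto)
      also have "kappa * (L - lam * s) = kappa * (x - lam * t) + 2 * pi * of_int m"
        using lam L by (simp add: s_def kappa field_simps)
      also have "exp (\<i> * of_real \<dots>) = exp (\<i> * of_real (kappa * (x - lam * t))) * exp (2 * of_int m * of_real pi * \<i>)"
        by (simp only: of_real_add distrib_left exp_add) (simp add: mult_ac)
      also have "\<dots> = exp (\<i> * of_real (kappa * (x - lam * t)))"
        using exp_integer_2pi[of "of_int m"] by simp
      finally show ?thesis .
    qed
  qed
  obtain n where "lam * t - x \<le> real n * L"
    using ex_less_of_nat_mult[OF L, of "lam * t - x"] by (auto intro: less_imp_le)
  then show ?thesis by (intro wraps[of x t n] x t) auto
qed

section \<open>The semi-discrete system\<close>

lemma periodic_int_shift:
  fixes f :: "int \<Rightarrow> 'a"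
  assumes "\<And>j. f (j + p) = f j"
  shows "f (j + k * p) = f j"
proof (induction k rule: int_induct[where k = 0])
  case base
  then show ?case by simp
next
  case (step1 k)
  then show ?case using assms[of "j + k * p"] by (simp add: algebra_simps)
next
  case (step2 k)
  then show ?case using assms[of "j + (k - 1) * p"] by (simp add: algebra_simps)
qed

lemma periodic_int_mod:
  fixes f :: "int \<Rightarrow> 'a"
  assumes "\<And>j. f (j + p) = f j"
  shows "f (j mod p) = f j"
  using periodic_int_shift[of f p "j mod p" "j div p", OF assms] by simp

lemma sum_periodic_shift:
  fixes f :: "int \<Rightarrow> 'a::ab_group_add"
  assumes per: "\<And>j. f (j + int N) = f j"
  shows "(\<Sum>j\<in>{0..<int N}. f (j + 1)) = (\<Sum>j\<in>{0..<int N}. f j)"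
proof (cases "N = 0")
  case False
  have "(\<Sum>j\<in>{0..<int N}. f (j + 1)) = (\<Sum>j\<in>{1..<int N + 1}. f j)"
    by (rule sum.reindex_bij_witness[of _ "\<lambda>j. j - 1" "\<lambda>j. j + 1"]) auto
  also have "{1..<int N + 1} = insert (int N) {1..<int N}" using False by auto
  also have "(\<Sum>j\<in>\<dots>. f j) = f (int N) + (\<Sum>j\<in>{1..<int N}. f j)" by simp
  also have "f (int N) = f 0" using per[of 0] by simp
  also have "f 0 + (\<Sum>j\<in>{1..<int N}. f j) = (\<Sum>j\<in>insert 0 {1..<int N}. f j)" by simp
  also have "insert 0 {1..<int N} = {0..<int N}" using False by auto
  finally show ?thesis .
qed simp

lemma sum_periodic_shift_back:
  fixes f :: "int \<Rightarrow> 'a::ab_group_add"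
  assumes per: "\<And>j. f (j + int N) = f j"
  shows "(\<Sum>j\<in>{0..<int N}. f (j - 1)) = (\<Sum>j\<in>{0..<int N}. f j)"
proof -
  have "f (j + int N - 1) = f (j - 1)" for j
    using per[of "j - 1"] by (simp add: algebra_simps)
  then show ?thesis
    using sum_periodic_shift[of "\<lambda>j. f (j - 1)" N] by simp
qed

lemma hybrid_variable_solution_periodic:
  assumes "hybrid_variable_solution L T lam N w wbar" "t \<in> {0..T}"
  shows "w (j + int N) t = w j t" "wbar (j + int N) t = wbar j t"
  using assms by (auto simp: hybrid_variable_solution_def)

lemma hybrid_variable_solution_derivs:
  assumes "hybrid_variable_solution L T lam N w wbar" "t \<in> {0..T}"
  shows "(wbar j has_vector_derivative - of_real (lam / mesh L N) * (w (j + 1) t - w j t)) (at t within {0..T})"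
    and "(w j has_vector_derivative - of_real (lam / mesh L N) *
      (w (j - 1) t - 7/2 * wbar (j - 1) t + 2 * w j t + 1/2 * wbar j t)) (at t within {0..T})"
proof -
  obtain dwbar dw where "(wbar j has_vector_derivative dwbar) (at t within {0..T})"
        "(w j has_vector_derivative dw) (at t within {0..T})"
        "dwbar + of_real (lam / mesh L N) * (w (j + 1) t - w j t) = 0"
        "dw + of_real (lam / mesh L N) *
          (w (j - 1) t - 7/2 * wbar (j - 1) t + 2 * w j t + 1/2 * wbar j t) = 0"
    using assms unfolding hybrid_variable_solution_def by blast
  then show "(wbar j has_vector_derivative - of_real (lam / mesh L N) * (w (j + 1) t - w j t)) (at t within {0..T})"
    and "(w j has_vector_derivative - of_real (lam / mesh L N) *
      (w (j - 1) t - 7/2 * wbar (j - 1) t + 2 * w j t + 1/2 * wbar j t)) (at t within {0..T})"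
    by (simp_all only: eq_neg_iff_add_eq_0[symmetric] mult_minus_left)
qed

text \<open>The system is linear and translation invariant. The deviation of a solution from the
  one-step rule \<open>w (j + 1) = c * w j\<close> is thus again a solution.\<close>

lemma hybrid_variable_solution_shift_diff:
  assumes sol: "hybrid_variable_solution L T lam N w wbar"
  shows "hybrid_variable_solution L T lam N (\<lambda>j t. w (j + 1) t - c * w j t)
           (\<lambda>j t. wbar (j + 1) t - c * wbar j t)"
  unfolding hybrid_variable_solution_def
proof (intro conjI allI ballI)
  fix j :: int and t assume t: "t \<in> {0..T}"
  show "w (j + int N + 1) t - c * w (j + int N) t = w (j + 1) t - c * w j t"
    "wbar (j + int N + 1) t - c * wbar (j + int N) t = wbar (j + 1) t - c * wbar j t"
    using hybrid_variable_solution_periodic[OF sol t, of j] hybrid_variable_solution_periodic[OF sol t, of "j + 1"]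
    by (simp_all add: ac_simps)
next
  fix j :: int and t assume t: "t \<in> {0..T}"
  note d = hybrid_variable_solution_derivs[OF sol t]
  note d' = has_vector_derivative_diff[OF d(1)[of "j + 1"] has_vector_derivative_mult_right[OF d(1)[of j]]]
     has_vector_derivative_diff[OF d(2)[of "j + 1"] has_vector_derivative_mult_right[OF d(2)[of j]]]
  show "\<exists>dwbar dw.
        ((\<lambda>t. wbar (j + 1) t - c * wbar j t) has_vector_derivative dwbar) (at t within {0..T}) \<and>
        ((\<lambda>t. w (j + 1) t - c * w j t) has_vector_derivative dw) (at t within {0..T}) \<and>
        dwbar + of_real (lam / mesh L N) * (w (j + 1 + 1) t - c * w (j + 1) t - (w (j + 1) t - c * w j t)) = 0 \<and>
        dw + of_real (lam / mesh L N) *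
          (w (j - 1 + 1) t - c * w (j - 1) t - 7/2 * (wbar (j - 1 + 1) t - c * wbar (j - 1) t)
             + 2 * (w (j + 1) t - c * w j t) + 1/2 * (wbar (j + 1) t - c * wbar j t)) = 0"
    by (rule exI, rule exI, rule conjI[OF d'(1)], rule conjI[OF d'(2)])
       (simp add: algebra_simps)
qed

lemma two_inner_mult_le:
  fixes x y :: complex
  shows "- (2 * (x \<bullet> y)) \<le> (cmod x)\<^sup>2 + (cmod y)\<^sup>2" "2 * (x \<bullet> y) \<le> (cmod x)\<^sup>2 + (cmod y)\<^sup>2"
  using power2_norm_eq_inner[of "x + y"] power2_norm_eq_inner[of "x - y"]
    zero_le_power2[of "norm (x + y)"] zero_le_power2[of "norm (x - y)"]
  by (auto simp: inner_add inner_diff power2_norm_eq_inner inner_commute)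

text \<open>The rate grows like \<open>1 / h\<close>, so this estimate yields uniqueness on a fixed mesh and bounds on
  coarse meshes, but not convergence. The factor 12 is generous:
  Young's inequality applied to each product of unknowns produces, after summation over a period, the coefficients 8 for \<open>w\<close> and 6 for \<open>wbar\<close>.\<close>

lemma hybrid_variable_energy_bound:
  assumes sol: "hybrid_variable_solution L T lam N w wbar"
    and T: "0 \<le> T" and pos: "0 \<le> lam / mesh L N" and t: "t \<in> {0..T}"
  defines "E \<equiv> \<lambda>t. \<Sum>j\<in>{0..<int N}. (cmod (w j t))\<^sup>2 + (cmod (wbar j t))\<^sup>2"
  shows "E t \<le> exp (12 * (lam / mesh L N) * t) * E 0"
proof -
  define c where "c = lam / mesh L N"
  define E' where "E' = (\<lambda>t. \<Sum>j\<in>{0..<int N}.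
      2 * (w j t \<bullet> (- of_real c * (w (j - 1) t - 7/2 * wbar (j - 1) t + 2 * w j t + 1/2 * wbar j t)))
    + 2 * (wbar j t \<bullet> (- of_real c * (w (j + 1) t - w j t))))"
  have der: "(E has_vector_derivative E' s) (at s within {0..T})" if s: "s \<in> {0..T}" for s
  proof -
    have square: "((\<lambda>s. (cmod (f s))\<^sup>2) has_vector_derivative 2 * (f s \<bullet> f')) (at s within {0..T})"
      if "(f has_vector_derivative f') (at s within {0..T})" for f :: "real \<Rightarrow> complex" and f'
    proof -
      have "((\<lambda>s. f s \<bullet> f s) has_vector_derivative (f s \<bullet> f' + f' \<bullet> f s)) (at s within {0..T})"
        by (rule bounded_bilinear.has_vector_derivative[OF bounded_bilinear_inner that that])
      then show ?thesis by (simp add: power2_norm_eq_inner inner_commute)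
    qed
    show ?thesis
      unfolding E_def E'_def c_def
      by (intro has_vector_derivative_sum has_vector_derivative_add square
            hybrid_variable_solution_derivs[OF sol s])
  qed
  have le: "E' s \<le> (12 * c) * E s" if s: "s \<in> {0..T}" for s
  proof -
    define A where "A j = (cmod (w j s))\<^sup>2" for j
    define B where "B j = (cmod (wbar j s))\<^sup>2" for j
    have "2 * (w j s \<bullet> (- of_real c * (w (j - 1) s - 7/2 * wbar (j - 1) s + 2 * w j s + 1/2 * wbar j s)))
      \<le> c * (A j + A (j - 1) + 7/2 * (A j + B (j - 1)) + 1/2 * (A j + B j))" for j
    proof -
      have "2 * (w j s \<bullet> (- of_real c * (w (j - 1) s - 7/2 * wbar (j - 1) s + 2 * w j s + 1/2 * wbar j s)))
         = c * (- (2 * (w j s \<bullet> w (j - 1) s)) + 7/2 * (2 * (w j s \<bullet> wbar (j - 1) s)) - 4 * (w j s \<bullet> w j s)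
             - 1/2 * (2 * (w j s \<bullet> wbar j s)))"
        by (simp add: inner_complex_def algebra_simps)
      also have "\<dots> \<le> c * (A j + A (j - 1) + 7/2 * (A j + B (j - 1)) + 1/2 * (A j + B j))"
      proof (rule mult_left_mono)
        have "- x1 + 7/2 * x2 - 4 * x4 - 1/2 * x3 \<le> a1 + a2 + 7/2 * (a1 + b1) + 1/2 * (a1 + b2)"
          if "- x1 \<le> a1 + a2" "x2 \<le> a1 + b1" "- x3 \<le> a1 + b2" "0 \<le> x4"
          for x1 x2 x3 x4 a1 a2 b1 b2 :: real
          using that by argo
        then show "- (2 * (w j s \<bullet> w (j - 1) s)) + 7/2 * (2 * (w j s \<bullet> wbar (j - 1) s))
            - 4 * (w j s \<bullet> w j s) - 1/2 * (2 * (w j s \<bullet> wbar j s))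
            \<le> A j + A (j - 1) + 7/2 * (A j + B (j - 1)) + 1/2 * (A j + B j)"
          unfolding A_def B_def using two_inner_mult_le inner_ge_zero by blast
      qed (use pos in \<open>simp add: c_def\<close>)
      finally show ?thesis .
    qed
    moreover have "2 * (wbar j s \<bullet> (- of_real c * (w (j + 1) s - w j s)))
        \<le> c * (2 * B j + A (j + 1) + A j)" for j
    proof -
      have "2 * (wbar j s \<bullet> (- of_real c * (w (j + 1) s - w j s)))
         = c * (- (2 * (wbar j s \<bullet> w (j + 1) s)) + 2 * (wbar j s \<bullet> w j s))"
        by (simp add: inner_complex_def algebra_simps)
      also have "\<dots> \<le> c * (2 * B j + A (j + 1) + A j)"
        using two_inner_mult_le(1)[of "wbar j s" "w (j + 1) s"] two_inner_mult_le(2)[of "wbar j s" "w j s"] pos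
        unfolding A_def B_def c_def by (intro mult_left_mono) linarith+
      finally show ?thesis .
    qed
    ultimately have "E' s \<le> (\<Sum>j\<in>{0..<int N}. c * (A j + A (j - 1) + 7/2 * (A j + B (j - 1)) + 1/2 * (A j + B j))
        + c * (2 * B j + A (j + 1) + A j))"
      unfolding E'_def by (intro sum_mono add_mono)
    also have "\<dots> = (\<Sum>j\<in>{0..<int N}. 6 * (c * A j) + c * A (j - 1) + c * A (j + 1)
        + 7/2 * (c * B (j - 1)) + 5/2 * (c * B j))"
      by (intro sum.cong) (simp_all add: field_simps)
    also have "\<dots> = c * (6 * (\<Sum>j\<in>{0..<int N}. A j) + (\<Sum>j\<in>{0..<int N}. A (j - 1)) + (\<Sum>j\<in>{0..<int N}. A (j + 1))
        + 7/2 * (\<Sum>j\<in>{0..<int N}. B (j - 1)) + 5/2 * (\<Sum>j\<in>{0..<int N}. B j))"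
      by (simp only: sum.distrib sum_distrib_left[symmetric]) (simp add: algebra_simps)
    also have "\<dots> = c * (8 * (\<Sum>j\<in>{0..<int N}. A j) + 6 * (\<Sum>j\<in>{0..<int N}. B j))"
      using sum_periodic_shift[of A N] sum_periodic_shift_back[of A N] sum_periodic_shift_back[of B N]
        hybrid_variable_solution_periodic[OF sol s] by (simp add: A_def B_def)
    also have "\<dots> \<le> c * (12 * (\<Sum>j\<in>{0..<int N}. A j) + 12 * (\<Sum>j\<in>{0..<int N}. B j))"
      using pos by (intro mult_left_mono add_mono mult_right_mono sum_nonneg) (auto simp: A_def B_def c_def)
    also have "\<dots> = (12 * c) * E s"
      by (simp add: E_def A_def B_def sum.distrib algebra_simps)
    finally show ?thesis .
  qed
  show ?thesis
    using exponential_growth_bound[OF T der le t] by (simp add: c_def)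
qed

lemma hybrid_variable_solution_zero:
  assumes sol: "hybrid_variable_solution L T lam N w wbar"
    and T: "0 \<le> T" and pos: "0 \<le> lam / mesh L N" and N: "N > 0"
    and init: "\<And>j. w j 0 = 0" "\<And>j. wbar j 0 = 0" and t: "t \<in> {0..T}"
  shows "w j t = 0" "wbar j t = 0"
proof -
  have "(\<Sum>j\<in>{0..<int N}. (cmod (w j t))\<^sup>2 + (cmod (wbar j t))\<^sup>2) \<le> 0"
    using hybrid_variable_energy_bound[OF sol T pos t] by (simp add: init)
  then have "(\<Sum>j\<in>{0..<int N}. (cmod (w j t))\<^sup>2 + (cmod (wbar j t))\<^sup>2) = 0"
    by (intro antisym sum_nonneg) auto
  then have 0: "w j t = 0 \<and> wbar j t = 0" if "j \<in> {0..<int N}" for j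
    using that by (subst (asm) sum_nonneg_eq_0_iff) (auto simp: add_nonneg_eq_0_iff)
  have "j mod int N \<in> {0..<int N}" using N by simp
  from 0[OF this] show "w j t = 0" "wbar j t = 0"
    using periodic_int_mod[of "\<lambda>j. w j t" "int N" j] periodic_int_mod[of "\<lambda>j. wbar j t" "int N" j]
      hybrid_variable_solution_periodic[OF sol t] by auto
qed

text \<open>Single-mode data stay single-mode, because the deviation from the rule
  \<open>w (j + 1) = exp z * w j\<close> is a solution with zero initial data.\<close>

lemma hybrid_variable_single_mode:
  assumes sol: "hybrid_variable_solution L T lam N w wbar"
    and T: "0 \<le> T" and pos: "0 \<le> lam / mesh L N" and N: "N > 0"
    and init: "\<And>j. w j 0 = exp (of_int j * z)" "\<And>j. wbar j 0 = exp (of_int j * z) * b0"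
    and t: "t \<in> {0..T}"
  shows "w j t = exp (of_int j * z) * w 0 t" "wbar j t = exp (of_int j * z) * wbar 0 t"
proof -
  have step: "w (j + 1) t - exp z * w j t = 0" "wbar (j + 1) t - exp z * wbar j t = 0" for j
    by (rule hybrid_variable_solution_zero[OF hybrid_variable_solution_shift_diff[OF sol] T pos N _ _ t];
        simp add: init exp_add distrib_right)+
  have *: "f j = exp (of_int j * z) * f 0" if "\<And>j. f (j + 1) - exp z * f j = 0" for f :: "int \<Rightarrow> complex"
  proof (induction j rule: int_induct[where k = 0])
    case base
    then show ?case by simp
  next
    case (step1 j)
    then show ?case using that[of j] by (simp add: exp_add distrib_right)
  next
    case (step2 j)
    then show ?case using that[of "j - 1"] by (simp add: exp_diff left_diff_distrib field_simps)
  qed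
  show "w j t = exp (of_int j * z) * w 0 t" using step(1) by (rule *)
  show "wbar j t = exp (of_int j * z) * wbar 0 t" using step(2) by (rule *)
qed

section \<open>Spectral analysis of a single mode\<close>

lemma quadratic_roots_exist:
  fixes p q :: complex
  obtains m1 m2 where "m1 + m2 = p" "m1 * m2 = q" "cmod (m1 - z) \<le> cmod (m2 - z)"
proof -
  define r where "r = csqrt (p\<^sup>2 - 4 * q)"
  have r: "r * r = p\<^sup>2 - 4 * q" using power2_csqrt[of "p\<^sup>2 - 4 * q"] by (simp add: r_def power2_eq_square)
  define a b where "a = (p + r) / 2" and "b = (p - r) / 2"
  have ab: "a + b = p" "a * b = q"
    using r by (simp_all add: a_def b_def field_simps power2_eq_square)
  show thesis
    using that[of a b] that[of b a] ab by (cases "cmod (a - z) \<le> cmod (b - z)") (auto simp: ac_simps)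
qed

lemma norm_exp_minus_one_le:
  fixes x :: complex
  shows "cmod (exp x - 1) \<le> cmod x * exp (cmod x)"
  using Taylor_exp_field[of x 0] by (simp add: mult.commute)

text \<open>The expression under the norm is minus the characteristic polynomial, evaluated at \<open>z\<close>, of the
  coefficient matrix of the mode equations; exact transport would make \<open>z\<close> an eigenvalue. The weights
  of the scheme make all Taylor coefficients up to order 4 cancel.\<close>

lemma symbol_defect_bound:
  fixes z :: complex
  assumes z: "cmod z \<le> 1"
  shows "cmod (z * (exp (- z) + 2) + (1/2 - 7/2 * exp (- z)) * (exp z - 1) - z\<^sup>2) \<le> cmod z ^ 5"
proof -
  define P where "P y = (\<Sum>i\<le>4. y ^ i / fact i)" for y :: complex
  have P: "P y = 1 + y + y\<^sup>2 / 2 + y ^ 3 / 6 + y ^ 4 / 24" for y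
    by (simp add: P_def fact_numeral atMost_Suc numeral_eq_Suc field_simps)
  define r1 r2 where "r1 = exp z - P z" and "r2 = exp (- z) - P (- z)"
  have "exp 1 \<le> (3::real)" using exp_le by simp
  then have e: "exp (cmod z) \<le> 3" using z order_trans[of "exp (cmod z)" "exp 1" 3] by simp
  have r: "cmod (exp y - P y) \<le> cmod z ^ 5 / 8" if "cmod y = cmod z" for y
  proof -
    have "cmod (exp y - P y) \<le> exp (cmod y) * (cmod y ^ 5) / 24"
      using Taylor_exp_field[of y 4] by (simp add: P_def fact_numeral)
    also have "\<dots> \<le> 3 * (cmod y ^ 5) / 24"
      using e that by (intro divide_right_mono mult_right_mono) auto
    finally show ?thesis using that by simp
  qed
  have r12: "cmod r1 \<le> cmod z ^ 5 / 8" "cmod r2 \<le> cmod z ^ 5 / 8"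
    using r[of z] r[of "- z"] by (simp_all add: r1_def r2_def)
  have "z * (exp (- z) + 2) + (1/2 - 7/2 * exp (- z)) * (exp z - 1) - z\<^sup>2
      = (z + 7/2) * exp (- z) + exp z / 2 + 2 * z - 4 - z\<^sup>2"
    by (simp add: exp_minus field_simps power2_eq_square)
  also have "\<dots> = z ^ 5 / 24 + (z + 7/2) * r2 + r1 / 2"
    by (simp add: r1_def r2_def P field_simps power2_eq_square power3_eq_cube power4_eq_xxxx power_numeral_reduce)
  also have "cmod \<dots> \<le> cmod z ^ 5 / 24 + cmod (z + 7/2) * cmod r2 + cmod r1 / 2"
    by (rule order_trans[OF norm_triangle_ineq add_mono[OF norm_triangle_le]])
       (simp_all add: norm_mult norm_divide norm_power)
  also have "\<dots> \<le> cmod z ^ 5 / 24 + (9/2) * (cmod z ^ 5 / 8) + (cmod z ^ 5 / 8) / 2"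
  proof (intro add_mono mult_mono divide_right_mono r12)
    show "cmod (z + 7/2) \<le> 9/2" using norm_triangle_ineq[of z "7/2"] z by simp
  qed auto
  also have "\<dots> \<le> cmod z ^ 5" by simp
  finally show ?thesis .
qed

text \<open>The mean of \<open>exp (s z)\<close> over \<open>s \<in> [0, 1]\<close>: the ratio between the average over a cell of a wave
  with phase increment \<open>z\<close> per cell and its value at the left end of the cell. The value 1 at
  \<open>z = 0\<close> is the limit.\<close>

definition mean_exp :: "complex \<Rightarrow> complex" where
  "mean_exp z = (if z = 0 then 1 else (exp z - 1) / z)"

lemma mult_mean_exp: "z * mean_exp z = exp z - 1"
  by (simp add: mean_exp_def)

lemma norm_mean_exp_le:
  assumes "Re z = 0"
  shows "cmod (mean_exp z) \<le> 1"
proof (cases "z = 0")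
  case False
  have z: "z = \<i> * of_real (Im z)" using assms by (simp add: complex_eq_iff)
  then have nz: "cmod z = \<bar>Im z\<bar>" by (metis norm_ii norm_mult mult_1 norm_of_real)
  have "cmod (exp z - 1) = 2 * \<bar>sin (Im z / 2)\<bar>" using dist_exp_i_1[of "Im z"] z by simp
  also have "\<dots> \<le> cmod z" using abs_sin_x_le_abs_x[of "Im z / 2"] nz by simp
  finally show ?thesis using False by (simp add: mean_exp_def norm_divide)
qed (simp add: mean_exp_def)

text \<open>The case of a mode resolved by the mesh, with \<open>c = \<lambda> / h\<close>. The coefficient matrix, acting on the
  pair \<open>(b, a)\<close>, has trace \<open>tr\<close> and determinant \<open>- s * q\<close>, and \<open>(- m2, s)\<close> and \<open>(q, m2)\<close> are
  left eigenvectors for \<open>m1\<close> and \<open>m2\<close>. They stay uniformly independent as \<open>z\<close> tends to 0, where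
  \<open>m1 = 0\<close> and \<open>m2 = 3\<close>.\<close>

lemma resolved_mode_error:
  fixes a b :: "real \<Rightarrow> complex" and z :: complex
  assumes T: "0 \<le> T" and c: "0 \<le> c" and z: "Re z = 0" "cmod z \<le> 1/2"
    and b': "\<And>t. t \<in> {0..T} \<Longrightarrow> (b has_vector_derivative - of_real c * ((exp z - 1) * a t)) (at t within {0..T})"
    and a': "\<And>t. t \<in> {0..T} \<Longrightarrow> (a has_vector_derivative
        - of_real c * ((exp (- z) + 2) * a t + (1/2 - 7/2 * exp (- z)) * b t)) (at t within {0..T})"
    and init: "a 0 = 1" "b 0 = mean_exp z"
  defines "M \<equiv> c * T * cmod z"
  shows "cmod (a T - exp (- (of_real c * z) * of_real T)) \<le> 8 * (12 * M * exp (2 * M) + 4) * cmod z ^ 4"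
    and "cmod (b T - exp (- (of_real c * z) * of_real T) * mean_exp z) \<le> 8 * (12 * M * exp (2 * M) + 4) * cmod z ^ 4"
proof -
  define s tr q e where "s = exp z - 1" and "tr = exp (- z) + 2" and "q = 1/2 - 7/2 * exp (- z)"
    and "e = exp (- (of_real c * z) * of_real T)"
  define \<phi> where "\<phi> = mean_exp z"
  define d where "d = z * tr + q * s - z\<^sup>2"
  have d_le: "cmod d \<le> cmod z ^ 5"
    using symbol_defect_bound[of z] z(2) by (simp add: d_def tr_def q_def s_def)
  have norms: "cmod s \<le> 2" "cmod tr \<le> 3" "cmod q \<le> 4" "cmod e = 1" "cmod \<phi> \<le> 1"
    using norm_triangle_ineq4[of "exp z" 1] norm_triangle_ineq[of "exp (- z)" 2]
      norm_triangle_ineq4[of "1/2" "7/2 * exp (- z)"] z norm_mean_exp_le[OF z(1)]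
    by (simp_all add: s_def tr_def q_def e_def norm_mult \<phi>_def)
  have s\<phi>: "z * \<phi> = s" by (simp add: \<phi>_def s_def mult_mean_exp)
  have Re_tr: "1 \<le> Re tr"
    using abs_Re_le_cmod[of "exp (- z)"] z by (simp add: tr_def)

  \<comment> \<open>Since \<open>tr - 2 * z\<close> is bounded away from 0, the root farther from \<open>z\<close> is at distance at least
      1/2; as the product of the two distances is \<open>cmod d\<close>, the nearer one is close to \<open>z\<close>.\<close>
  obtain m1 m2 where m: "m1 + m2 = tr" "m1 * m2 = - (s * q)" "cmod (m1 - z) \<le> cmod (m2 - z)"
    by (rule quadratic_roots_exist)
  have "1 \<le> cmod (tr - 2 * z)"
    using complex_Re_le_cmod[of "tr - 2 * z"] Re_tr z by simp
  also have "tr - 2 * z = (m1 - z) + (m2 - z)" using m(1) by (simp add: algebra_simps)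
  also have "cmod \<dots> \<le> 2 * cmod (m2 - z)" using m(3) norm_triangle_ineq[of "m1 - z" "m2 - z"] by simp
  finally have far: "1/2 \<le> cmod (m2 - z)" by simp
  have "(m1 - z) * (m2 - z) = m1 * m2 - z * (m1 + m2) + z\<^sup>2"
    by (simp add: algebra_simps power2_eq_square)
  also have "\<dots> = - d" by (simp only: m) (simp add: d_def algebra_simps)
  finally have "cmod (m1 - z) * cmod (m2 - z) = cmod d" by (metis norm_minus_cancel norm_mult)
  then have near: "cmod (m1 - z) \<le> 2 * cmod z ^ 5"
    using d_le mult_left_mono[OF far, of "cmod (m1 - z)"] by simp
  have z4: "cmod z ^ 5 \<le> cmod z ^ 4 / 2"
    using mult_right_mono[OF z(2), of "cmod z ^ 4"] by (simp add: power_numeral_reduce)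
  have z4': "cmod z ^ 4 \<le> (1/2) ^ 4" using z(2) by (intro power_mono) auto
  have near': "cmod (m1 - z) \<le> 1/16" using near z4 z4' by (simp add: power_numeral_reduce)
  have m2: "m2 = tr - m1" using m(1) by (simp add: algebra_simps)
  have Re_m2: "15/16 \<le> Re m2"
    using abs_Re_le_cmod[of "m1 - z"] near' Re_tr z by (simp add: m2)
  have m2_ge: "15/16 \<le> cmod m2" using Re_m2 complex_Re_le_cmod[of m2] by linarith
  have m2_le: "cmod m2 \<le> 4"
    using norm_triangle_ineq4[of tr m1] norm_triangle_ineq[of "m1 - z" z] near' norms z by (simp add: m2)
  have gap: "7/8 \<le> cmod (m2 - m1)"
  proof -
    have "Re (m2 - m1) = Re tr - 2 * Re (m1 - z)" using z by (simp add: m2)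
    then show ?thesis
      using abs_Re_le_cmod[of "m1 - z"] near' Re_tr complex_Re_le_cmod[of "m2 - m1"] by linarith
  qed
  define D where "D = m2 * (m2 - m1)"
  have D_ge: "1/2 \<le> cmod D"
    using mult_mono[OF m2_ge gap] by (simp add: D_def norm_mult)

  \<comment> \<open>The characteristic variables: \<open>U\<close> carries the wave, \<open>V\<close> is damped. The determinant of the
      change of variables is \<open>- D\<close>.\<close>
  define U V where "U = (\<lambda>t. - m2 * b t + s * a t)" and "V = (\<lambda>t. q * b t + m2 * a t)"
  have "(U has_vector_derivative - (of_real c * m1) * U t) (at t within {0..T})" if t: "t \<in> {0..T}" for t
  proof -
    have "(U has_vector_derivative - m2 * (- of_real c * (s * a t)) + s * (- of_real c * (tr * a t + q * b t)))
        (at t within {0..T})"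
      unfolding U_def s_def tr_def q_def by (intro derivative_intros b'[OF t] a'[OF t])
    also have "- m2 * (- of_real c * (s * a t)) + s * (- of_real c * (tr * a t + q * b t))
       = - of_real c * (s * (tr - m2) * a t + (s * q) * b t)"
      by (simp add: algebra_simps)
    also have "\<dots> = - of_real c * (s * m1 * a t + (- (m1 * m2)) * b t)"
      using m by (simp add: m2)
    also have "\<dots> = - (of_real c * m1) * U t"
      by (simp add: U_def algebra_simps)
    finally show ?thesis .
  qed
  from linear_ode_solution[OF T this, of T] have U: "U T = exp (- (of_real c * m1) * of_real T) * U 0"
    using T by simp
  have "(V has_vector_derivative - (of_real c * m2) * V t) (at t within {0..T})" if t: "t \<in> {0..T}" for t
  proof -
    have "(V has_vector_derivative q * (- of_real c * (s * a t)) + m2 * (- of_real c * (tr * a t + q * b t)))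
        (at t within {0..T})"
      unfolding V_def s_def tr_def q_def by (intro derivative_intros b'[OF t] a'[OF t])
    also have "q * (- of_real c * (s * a t)) + m2 * (- of_real c * (tr * a t + q * b t))
       = - of_real c * (((s * q) + m2 * tr) * a t + m2 * q * b t)"
      by (simp add: algebra_simps)
    also have "(s * q) + m2 * tr = m2 * m2"
    proof -
      have "s * q = - (m1 * m2)" using m(2) by simp
      then show ?thesis by (simp add: m(1)[symmetric] algebra_simps)
    qed
    also have "- of_real c * (m2 * m2 * a t + m2 * q * b t) = - (of_real c * m2) * V t"
      by (simp add: V_def algebra_simps)
    finally show ?thesis .
  qed
  from linear_ode_solution[OF T this, of T] have V: "V T = exp (- (of_real c * m2) * of_real T) * V 0"
    using T by simp

  have U0: "U 0 = - m2 * \<phi> + s" and V0: "V 0 = q * \<phi> + m2"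
    by (simp_all add: U_def V_def init \<phi>_def)
  have U_err: "cmod (U T - e * U 0) \<le> 12 * M * exp (2 * M) * cmod z ^ 4"
  proof -
    \<comment> \<open>the relative phase and amplitude error of the wave mode is \<open>exp x - 1\<close>\<close>
    define x where "x = - (of_real c * (m1 - z)) * of_real T"
    have M0: "0 \<le> M" using c T by (simp add: M_def)
    have "cmod x = c * T * cmod (m1 - z)" using c T by (simp add: x_def norm_mult)
    also have "\<dots> \<le> c * T * (2 * cmod z ^ 5)" using near c T by (intro mult_left_mono) auto
    also have "\<dots> = 2 * M * cmod z ^ 4" by (simp add: M_def power_numeral_reduce)
    finally have x: "cmod x \<le> 2 * M * cmod z ^ 4" .
    also have "\<dots> \<le> 2 * M * 1" using z4' M0 by (intro mult_left_mono) (auto simp: power_numeral_reduce)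
    finally have x2: "cmod x \<le> 2 * M" by simp
    have "exp (- (of_real c * m1) * of_real T) = e * exp x"
      by (simp add: e_def x_def exp_add[symmetric] algebra_simps)
    then have "U T - e * U 0 = e * U 0 * (exp x - 1)" by (simp add: U algebra_simps)
    then have "cmod (U T - e * U 0) = cmod (U 0) * cmod (exp x - 1)" using norms by (simp add: norm_mult)
    also have "\<dots> \<le> 6 * (cmod x * exp (cmod x))"
    proof (intro mult_mono norm_exp_minus_one_le)
      have "cmod (U 0) \<le> cmod (m2 * \<phi>) + cmod s"
        unfolding U0 using norm_triangle_ineq[of "- m2 * \<phi>" s] by simp
      also have "cmod (m2 * \<phi>) \<le> 4 * 1"
        unfolding norm_mult using m2_le norms by (intro mult_mono) auto
      finally show "cmod (U 0) \<le> 6" using norms by simp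
    qed auto
    also have "\<dots> \<le> 6 * ((2 * M * cmod z ^ 4) * exp (2 * M))"
      using x x2 M0 by (intro mult_left_mono mult_mono) auto
    finally show ?thesis by (simp add: mult_ac)
  qed
  have V_err: "cmod (V T - e * V 0) \<le> 4 * cmod z ^ 4"
  proof -
    \<comment> \<open>The truncation error of the nodal equation. For \<open>z = 0\<close> dividing \<open>z * \<tau> = d\<close> by \<open>z\<close> is
        impossible, but then \<open>\<tau>\<close> vanishes by the choice \<open>mean_exp 0 = 1\<close>.\<close>
    define \<tau> where "\<tau> = tr + q * \<phi> - z"
    have "z * \<tau> = d" by (simp add: \<tau>_def d_def s\<phi>[symmetric] power2_eq_square algebra_simps)
    then have "cmod z * cmod \<tau> \<le> cmod z * cmod z ^ 4"
      using d_le by (simp add: norm_mult[symmetric] power_numeral_reduce)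
    moreover have "\<tau> = 0" if "z = 0"
      using that by (simp add: \<tau>_def tr_def q_def \<phi>_def mean_exp_def)
    ultimately have \<tau>: "cmod \<tau> \<le> cmod z ^ 4" by (cases "z = 0") auto
    have "V 0 = \<tau> - (m1 - z)" by (simp add: V0 \<tau>_def m2)
    then have "cmod (V 0) \<le> cmod \<tau> + cmod (m1 - z)" using norm_triangle_ineq4 by metis
    also have "\<dots> \<le> 2 * cmod z ^ 4" using \<tau> near z4 by simp
    finally have V0_le: "cmod (V 0) \<le> 2 * cmod z ^ 4" .
    have decay: "cmod (exp (- (of_real c * m2) * of_real T)) \<le> 1"
      using c T Re_m2 by simp
    have "cmod (V T - e * V 0) = cmod (exp (- (of_real c * m2) * of_real T) - e) * cmod (V 0)"
      by (simp add: V norm_mult[symmetric] left_diff_distrib)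
    also have "\<dots> \<le> 2 * (2 * cmod z ^ 4)"
    proof (rule mult_mono[OF _ V0_le])
      show "cmod (exp (- (of_real c * m2) * of_real T) - e) \<le> 2"
        using decay norms(4) norm_triangle_ineq4[of "exp (- (of_real c * m2) * of_real T)" e] by linarith
    qed auto
    finally show ?thesis by simp
  qed
  have sum_err: "4 * (cmod (U T - e * U 0) + cmod (V T - e * V 0)) / cmod D
      \<le> 8 * (12 * M * exp (2 * M) + 4) * cmod z ^ 4"
  proof -
    have "4 * (cmod (U T - e * U 0) + cmod (V T - e * V 0)) / cmod D
        \<le> 4 * (cmod (U T - e * U 0) + cmod (V T - e * V 0)) / (1/2)"
      using D_ge by (intro divide_left_mono) (auto intro!: mult_pos_pos)
    also have "\<dots> \<le> 8 * (12 * M * exp (2 * M) * cmod z ^ 4 + 4 * cmod z ^ 4)"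
      using U_err V_err by simp
    finally show ?thesis by (simp add: algebra_simps)
  qed
  have sq: "s * q = - (m1 * m2)" using m(2) by simp
  have inv_a: "q * (U T - e * U 0) + m2 * (V T - e * V 0) = D * (a T - e)"
  proof -
    have "q * (U T - e * U 0) + m2 * (V T - e * V 0) = (s * q + m2 * m2) * (a T - e)"
      by (simp add: U_def V_def init algebra_simps)
    also have "s * q + m2 * m2 = D" unfolding sq by (simp add: D_def algebra_simps)
    finally show ?thesis .
  qed
  have inv_b: "s * (V T - e * V 0) - m2 * (U T - e * U 0) = D * (b T - e * \<phi>)"
  proof -
    have "s * (V T - e * V 0) - m2 * (U T - e * U 0) = (s * q + m2 * m2) * (b T - e * \<phi>)"
      by (simp add: U_def V_def init \<phi>_def algebra_simps)
    also have "s * q + m2 * m2 = D" unfolding sq by (simp add: D_def algebra_simps)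
    finally show ?thesis .
  qed
  have solve: "cmod y \<le> 8 * (12 * M * exp (2 * M) + 4) * cmod z ^ 4"
    if "cmod (D * y) \<le> k * cmod (U T - e * U 0) + l * cmod (V T - e * V 0)" "k \<le> 4" "l \<le> 4" for y k l
  proof -
    have "cmod (D * y) \<le> 4 * cmod (U T - e * U 0) + 4 * cmod (V T - e * V 0)"
      using that mult_right_mono[of k 4 "cmod (U T - e * U 0)"] mult_right_mono[of l 4 "cmod (V T - e * V 0)"]
      by simp
    then have "cmod y \<le> 4 * (cmod (U T - e * U 0) + cmod (V T - e * V 0)) / cmod D"
      using D_ge by (subst pos_le_divide_eq) (auto simp: norm_mult mult.commute)
    then show ?thesis using sum_err by linarith
  qed
  have "cmod (D * (a T - e)) \<le> cmod q * cmod (U T - e * U 0) + cmod m2 * cmod (V T - e * V 0)"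
    unfolding inv_a[symmetric] using norm_triangle_ineq by (metis norm_mult)
  then show "cmod (a T - exp (- (of_real c * z) * of_real T)) \<le> 8 * (12 * M * exp (2 * M) + 4) * cmod z ^ 4"
    using solve norms m2_le unfolding e_def by blast
  have "cmod (D * (b T - e * \<phi>)) \<le> cmod m2 * cmod (U T - e * U 0) + cmod s * cmod (V T - e * V 0)"
    unfolding inv_b[symmetric] using norm_triangle_ineq4 by (metis norm_mult add.commute)
  moreover have "cmod s \<le> 4" using norms by simp
  ultimately show "cmod (b T - exp (- (of_real c * z) * of_real T) * mean_exp z)
      \<le> 8 * (12 * M * exp (2 * M) + 4) * cmod z ^ 4"
    using solve m2_le unfolding e_def \<phi>_def by blast
qed

section \<open>Error estimate on all meshes\<close>

lemma mesh_pos: "L > 0 \<Longrightarrow> N > 0 \<Longrightarrow> mesh L N > 0"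
  by (simp add: mesh_def)

lemma node_in_interval:
  assumes "L > 0" "N > 0" "j \<in> {0..int N}"
  shows "node L N j \<in> {0..L}"
proof -
  have "real_of_int j \<le> real N" using assms by (metis atLeastAtMost_iff of_int_le_iff of_int_of_nat_eq)
  then show ?thesis
    using assms by (auto simp: node_def mesh_def field_simps)
qed

lemma cell_average_wave:
  fixes kappa s :: real
  assumes h: "mesh L N > 0"
  defines "z \<equiv> \<i> * of_real (kappa * mesh L N)"
  shows "cell_average L N j (\<lambda>x. exp (\<i> * of_real (kappa * (x - s))))
     = exp (of_int j * z) * (exp (- (\<i> * of_real (kappa * s))) * mean_exp z)"
proof (cases "kappa = 0")
  case True
  then show ?thesis
    using h by (simp add: cell_average_def node_def z_def mean_exp_def scaleR_conv_of_real algebra_simps)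
next
  case False
  let ?h = "mesh L N" and ?k = "\<i> * complex_of_real kappa"
  have k: "?k \<noteq> 0" using False by simp
  define F where "F = (\<lambda>x. exp (\<i> * of_real (kappa * (x - s))) / ?k)"
  have "(F has_vector_derivative exp (\<i> * of_real (kappa * (x - s)))) (at x within S)" for x S
  proof -
    have "((\<lambda>x. exp (?k * (x - of_real s)) / ?k) has_field_derivative exp (?k * (of_real x - of_real s)))
        (at (of_real x))"
      using k by (auto intro!: derivative_eq_intros)
    from has_vector_derivative_real_field[OF this] show ?thesis
      by (simp add: F_def mult_ac)
  qed
  then have integral: "((\<lambda>x. exp (\<i> * of_real (kappa * (x - s)))) has_integral
      F (node L N (j + 1)) - F (node L N j)) {node L N j..node L N (j + 1)}"
    using h by (intro fundamental_theorem_of_calculus) (auto simp: node_def)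
  have F_node: "F (node L N i) = exp (of_int i * z) * exp (- (\<i> * of_real (kappa * s))) / ?k" for i
    by (simp add: F_def exp_add[symmetric] node_def z_def algebra_simps)
  have "cell_average L N j (\<lambda>x. exp (\<i> * of_real (kappa * (x - s))))
      = (F (node L N (j + 1)) - F (node L N j)) / of_real ?h"
    unfolding cell_average_def integral_unique[OF integral] by simp
  also have "\<dots> = (exp (of_int (j + 1) * z) * exp (- (\<i> * of_real (kappa * s))) / ?k
        - exp (of_int j * z) * exp (- (\<i> * of_real (kappa * s))) / ?k) / of_real ?h"
    by (simp only: F_node)
  also have "\<dots> = exp (of_int j * z) * (exp (- (\<i> * of_real (kappa * s))) * ((exp z - 1) / z))"
    using h k by (simp add: z_def exp_add distrib_right field_simps)
  finally show ?thesis
    using h False by (simp add: mean_exp_def z_def)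
qed

lemma periodic_mode:
  assumes "L > 0" "N > 0" "kappa = 2 * of_int m * pi / L"
  shows "exp (of_int (j + int N) * (\<i> * complex_of_real (kappa * mesh L N)))
       = exp (of_int j * (\<i> * complex_of_real (kappa * mesh L N)))"
proof -
  have "kappa * mesh L N * real N = 2 * pi * of_int m"
    using assms by (simp add: mesh_def)
  moreover have "of_nat N * (\<i> * complex_of_real (kappa * mesh L N))
      = of_real (kappa * mesh L N * real N) * \<i>"
    by simp
  ultimately have "exp (of_nat N * (\<i> * complex_of_real (kappa * mesh L N)))
      = exp (complex_of_real (2 * of_int m * pi) * \<i>)"
    by (simp only: mult_ac)
  also have "\<dots> = 1" by (rule exp_integer_2pi) simp
  finally have "exp (of_nat N * (\<i> * complex_of_real (kappa * mesh L N))) = 1" .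
  then show ?thesis
    by (simp only: of_int_add of_int_of_nat_eq distrib_right exp_add mult_1_right)
qed

text \<open>The factor of \<open>h\<^sup>4\<close> in the error estimate. The first summand in parentheses serves
  the resolved modes, with \<open>M = (\<lambda> / h) T \<bar>z\<bar>\<close>, which does not
  depend on the mesh. The second covers coarse meshes, where \<open>1 \<le> 16 (\<bar>\<kappa>\<bar> h)\<^sup>4\<close> and the
  energy estimate bounds the discrete solution by \<open>2 exp (24 M)\<close>, the exact one being bounded by 1.\<close>

definition error_constant :: "real \<Rightarrow> real \<Rightarrow> real \<Rightarrow> real" where
  "error_constant T lam kappa = (let M = lam * \<bar>kappa\<bar> * T in
     (8 * (12 * M * exp (2 * M) + 4) + 16 * (2 * exp (24 * M) + 1)) * \<bar>kappa\<bar> ^ 4)"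

lemma single_mode_error:
  fixes kappa :: real
  assumes sol: "hybrid_variable_solution L T lam N w wbar"
    and L: "L > 0" and T: "T > 0" and lam: "lam > 0" and N: "N > 0"
  defines "z \<equiv> \<i> * of_real (kappa * mesh L N)"
  assumes mode: "\<And>j t. t \<in> {0..T} \<Longrightarrow> w j t = exp (of_int j * z) * w 0 t"
      "\<And>j t. t \<in> {0..T} \<Longrightarrow> wbar j t = exp (of_int j * z) * wbar 0 t"
    and init: "w 0 0 = 1" "wbar 0 0 = mean_exp z"
  defines "e \<equiv> exp (- (\<i> * of_real (kappa * (lam * T))))"
  shows "cmod (w 0 T - e) \<le> error_constant T lam kappa * mesh L N ^ 4"
    and "cmod (wbar 0 T - e * mean_exp z) \<le> error_constant T lam kappa * mesh L N ^ 4"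
proof -
  define h where "h = mesh L N"
  define c where "c = lam / h"
  define M where "M = lam * \<bar>kappa\<bar> * T"
  define C1 C2 where "C1 = 8 * (12 * M * exp (2 * M) + 4)" and "C2 = 16 * (2 * exp (24 * M) + 1)"
  have h: "h > 0" using L N by (simp add: h_def mesh_pos)
  have c: "c > 0" using lam h by (simp add: c_def)
  have M: "M \<ge> 0" using lam T by (simp add: M_def)
  have C: "error_constant T lam kappa = (C1 + C2) * \<bar>kappa\<bar> ^ 4"
    by (simp only: error_constant_def Let_def M_def C1_def C2_def)
  have "C1 \<ge> 0" "C2 \<ge> 0"
    unfolding C1_def C2_def using M by (auto intro!: add_nonneg_nonneg mult_nonneg_nonneg)
  then have C1: "C1 * (\<bar>kappa\<bar> * h) ^ 4 \<le> error_constant T lam kappa * h ^ 4"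
    and C2: "C2 * (\<bar>kappa\<bar> * h) ^ 4 \<le> error_constant T lam kappa * h ^ 4"
    unfolding C power_mult_distrib mult.assoc[symmetric] by (intro mult_right_mono; simp)+
  have Re_z: "Re z = 0" and norm_z: "cmod z = \<bar>kappa\<bar> * h"
    using h by (simp_all add: z_def h_def norm_mult)
  have cz: "of_real c * z = \<i> * of_real (kappa * lam)"
    using h by (simp add: c_def z_def h_def)
  then have e: "e = exp (- (of_real c * z) * of_real T)"
    by (simp add: e_def mult_ac)
  have norm_e: "cmod e = 1" by (simp add: e_def)
  have "cmod (w 0 T - e) \<le> error_constant T lam kappa * h ^ 4 \<and>
        cmod (wbar 0 T - e * mean_exp z) \<le> error_constant T lam kappa * h ^ 4"
  proof (cases "cmod z \<le> 1/2")
    case True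
    have "(wbar 0 has_vector_derivative - of_real c * ((exp z - 1) * w 0 t)) (at t within {0..T})"
      if t: "t \<in> {0..T}" for t
      using hybrid_variable_solution_derivs(1)[OF sol t, of 0] mode(1)[OF t, of 1]
      by (simp add: c_def h_def left_diff_distrib)
    moreover have "(w 0 has_vector_derivative - of_real c * ((exp (- z) + 2) * w 0 t
        + (1/2 - 7/2 * exp (- z)) * wbar 0 t)) (at t within {0..T})"
      if t: "t \<in> {0..T}" for t
    proof -
      have "w (- 1) t - 7/2 * wbar (- 1) t + 2 * w 0 t + 1/2 * wbar 0 t
          = (exp (- z) + 2) * w 0 t + (1/2 - 7/2 * exp (- z)) * wbar 0 t"
        using mode[OF t, of "- 1"] by (simp add: algebra_simps)
      then show ?thesis
        using hybrid_variable_solution_derivs(2)[OF sol t, of 0] by (simp add: c_def h_def)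
    qed
    moreover have "c * T * cmod z = M" using h by (simp add: c_def norm_z M_def)
    ultimately have "cmod (w 0 T - e) \<le> C1 * cmod z ^ 4"
        "cmod (wbar 0 T - e * mean_exp z) \<le> C1 * cmod z ^ 4"
      using resolved_mode_error[where a = "w 0" and b = "wbar 0" and c = c and T = T and z = z] T c Re_z True init
      by (simp_all add: e C1_def)
    then show ?thesis using C1 unfolding norm_z by linarith
  next
    case False
    \<comment> \<open>Under-resolved wave: \<open>1 < 2 * \<bar>kappa\<bar> * h\<close>, so the rate \<open>c\<close> is bounded independently of
        the mesh.\<close>
    define G where "G = 2 * exp (24 * M)"
    have "1 \<le> exp (24 * M)" using M by simp
    then have G: "1 \<le> G" unfolding G_def by linarith
    have "c * T \<le> 2 * M"
    proof -
      have "c * 1 \<le> c * (2 * (\<bar>kappa\<bar> * h))" using False c by (intro mult_left_mono) (auto simp: norm_z)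
      also have "\<dots> = 2 * lam * \<bar>kappa\<bar>" using h by (simp add: c_def)
      finally show ?thesis using T by (simp add: M_def mult_right_mono mult.assoc[symmetric])
    qed
    then have "12 * c * T \<le> 24 * M" by linarith
    then have growth: "exp (12 * c * T) \<le> exp (24 * M)" by (simp only: exp_le_cancel_iff)
    have energy: "(\<Sum>j\<in>{0..<int N}. (cmod (w j t))\<^sup>2 + (cmod (wbar j t))\<^sup>2)
        = N * ((cmod (w 0 t))\<^sup>2 + (cmod (wbar 0 t))\<^sup>2)" if t: "t \<in> {0..T}" for t
    proof -
      have "(\<Sum>j\<in>{0..<int N}. (cmod (w j t))\<^sup>2 + (cmod (wbar j t))\<^sup>2)
          = (\<Sum>j\<in>{0..<int N}. (cmod (w 0 t))\<^sup>2 + (cmod (wbar 0 t))\<^sup>2)"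
      proof (rule sum.cong)
        fix j
        have "cmod (exp (of_int j * z)) = 1" using Re_z by simp
        then show "(cmod (w j t))\<^sup>2 + (cmod (wbar j t))\<^sup>2 = (cmod (w 0 t))\<^sup>2 + (cmod (wbar 0 t))\<^sup>2"
          using mode[OF t, of j] by (metis mult_1 norm_mult)
      qed simp
      then show ?thesis by simp
    qed
    have "N * ((cmod (w 0 T))\<^sup>2 + (cmod (wbar 0 T))\<^sup>2)
        \<le> exp (12 * c * T) * (N * ((cmod (w 0 0))\<^sup>2 + (cmod (wbar 0 0))\<^sup>2))"
      using hybrid_variable_energy_bound[OF sol, of T] energy[of T] energy[of 0] T c by (simp add: c_def h_def)
    also have "\<dots> = N * (exp (12 * c * T) * (1 + (cmod (mean_exp z))\<^sup>2))"
      by (simp add: init)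
    finally have "(cmod (w 0 T))\<^sup>2 + (cmod (wbar 0 T))\<^sup>2 \<le> exp (12 * c * T) * (1 + (cmod (mean_exp z))\<^sup>2)"
      using N by simp
    also have "\<dots> \<le> exp (24 * M) * (1 + 1)"
      using growth norm_mean_exp_le[OF Re_z] by (intro mult_mono add_mono power_le_one) auto
    finally have sq: "(cmod (w 0 T))\<^sup>2 + (cmod (wbar 0 T))\<^sup>2 \<le> G" by (simp add: G_def)
    have bd: "r \<le> G" if "r\<^sup>2 \<le> G" for r :: real
    proof (rule ccontr)
      assume "\<not> r \<le> G"
      then have "G * 1 < r * r" using G by (intro mult_strict_mono') auto
      then show False using that by (simp add: power2_eq_square)
    qed
    have "G + 1 \<le> error_constant T lam kappa * h ^ 4"
    proof -
      have "(1/2) ^ 4 \<le> (\<bar>kappa\<bar> * h) ^ 4" using False by (intro power_mono) (auto simp: norm_z)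
      then have "(G + 1) * 1 \<le> (G + 1) * (16 * (\<bar>kappa\<bar> * h) ^ 4)"
        using G by (intro mult_left_mono) (auto simp: power_one_over)
      also have "\<dots> = C2 * (\<bar>kappa\<bar> * h) ^ 4" by (simp add: C2_def G_def)
      also have "\<dots> \<le> error_constant T lam kappa * h ^ 4" by (rule C2)
      finally show ?thesis by simp
    qed
    moreover have "cmod (w 0 T - e) \<le> G + 1"
      using bd[of "cmod (w 0 T)"] sq norm_e norm_triangle_ineq4[of "w 0 T" e]
        zero_le_power2[of "cmod (wbar 0 T)"] by linarith
    moreover have "cmod (wbar 0 T - e * mean_exp z) \<le> G + 1"
      using bd[of "cmod (wbar 0 T)"] sq norm_e norm_triangle_ineq4[of "wbar 0 T" "e * mean_exp z"]
        norm_mean_exp_le[OF Re_z] zero_le_power2[of "cmod (w 0 T)"] norm_mult[of e "mean_exp z"] by simp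
    ultimately show ?thesis by linarith
  qed
  then show "cmod (w 0 T - e) \<le> error_constant T lam kappa * mesh L N ^ 4"
    and "cmod (wbar 0 T - e * mean_exp z) \<le> error_constant T lam kappa * mesh L N ^ 4"
    by (simp_all add: h_def)
qed

lemma hybrid_variable_wave_error:
  fixes L T lam kappa :: real
  assumes L: "L > 0" and T: "T > 0" and lam: "lam > 0" and kappa: "kappa = 2 * of_int m * pi / L"
    and N: "N > 0"
    and exact: "periodic_advection_solution L T lam (\<lambda>x. exp (\<i> * of_real (kappa * x))) wstar"
    and sol: "hybrid_variable_solution L T lam N w wbar"
    and data: "exact_initial_data L N wstar w wbar"
  shows "\<forall>j\<in>{0..int N}. cmod (w j T - wstar (node L N j) T) \<le> error_constant T lam kappa * mesh L N ^ 4"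
    and "\<forall>j\<in>{0..<int N}. cmod (wbar j T - cell_average L N j (\<lambda>x. wstar x T))
           \<le> error_constant T lam kappa * mesh L N ^ 4"
proof -
  define z where "z = \<i> * complex_of_real (kappa * mesh L N)"
  define E where "E t = exp (- (\<i> * of_real (kappa * (lam * t))))" for t
  note h = mesh_pos[OF L N]
  have norm_mode: "cmod (exp (of_int j * z)) = 1" for j by (simp add: z_def)
  have nodal: "wstar (node L N j) t = exp (of_int j * z) * E t" if "j \<in> {0..int N}" "t \<in> {0..T}" for j t
    using advection_solution_eq[OF L T lam kappa exact node_in_interval[OF L N that(1)] that(2)]
    by (simp add: node_def z_def E_def exp_add[symmetric] algebra_simps)
  have average: "cell_average L N j (\<lambda>x. wstar x t) = exp (of_int j * z) * (E t * mean_exp z)"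
    if j: "j \<in> {0..<int N}" and t: "t \<in> {0..T}" for j t
  proof -
    have "node L N j \<in> {0..L}" "node L N (j + 1) \<in> {0..L}"
      using node_in_interval[OF L N, of j] node_in_interval[OF L N, of "j + 1"] j by auto
    then have "integral {node L N j..node L N (j + 1)} (\<lambda>x. wstar x t)
        = integral {node L N j..node L N (j + 1)} (\<lambda>x. exp (\<i> * of_real (kappa * (x - lam * t))))"
      using t by (intro integral_cong advection_solution_eq[OF L T lam kappa exact]) auto
    then show ?thesis
      using cell_average_wave[OF h, of j kappa "lam * t"] by (simp add: cell_average_def z_def E_def)
  qed
  have E0: "E 0 = 1" by (simp add: E_def)
  have T0: "0 \<in> {0..T}" "T \<in> {0..T}" using T by auto
  note periodic = hybrid_variable_solution_periodic[OF sol T0(1)]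
  have mode_mod: "exp (of_int (j mod int N) * z) = exp (of_int j * z)" for j
    using periodic_int_mod[of "\<lambda>j. exp (of_int j * z)" "int N" j] periodic_mode[OF L N kappa] by (simp add: z_def)
  have init: "w j 0 = exp (of_int j * z)" "wbar j 0 = exp (of_int j * z) * mean_exp z" for j
  proof -
    have j: "j mod int N \<in> {0..int N}" "j mod int N \<in> {0..<int N}" using N by (auto intro: less_imp_le)
    have "w (j mod int N) 0 = exp (of_int (j mod int N) * z)"
        "wbar (j mod int N) 0 = exp (of_int (j mod int N) * z) * mean_exp z"
      using data j nodal[OF j(1) T0(1)] average[OF j(2) T0(1)]
      by (simp_all add: exact_initial_data_def E0)
    then show "w j 0 = exp (of_int j * z)" "wbar j 0 = exp (of_int j * z) * mean_exp z"
      using periodic_int_mod[of "\<lambda>j. w j 0" "int N" j] periodic_int_mod[of "\<lambda>j. wbar j 0" "int N" j]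
      by (simp_all add: periodic mode_mod)
  qed
  have mode: "w j t = exp (of_int j * z) * w 0 t" "wbar j t = exp (of_int j * z) * wbar 0 t"
    if "t \<in> {0..T}" for j t
  proof -
    have "0 \<le> T" "0 \<le> lam / mesh L N" using T lam h by simp_all
    note hybrid_variable_single_mode[OF sol this N init that]
    then show "w j t = exp (of_int j * z) * w 0 t" "wbar j t = exp (of_int j * z) * wbar 0 t" .
  qed
  note err = single_mode_error[OF sol L T lam N, of kappa, folded z_def E_def, OF mode]
  have err: "cmod (w 0 T - E T) \<le> error_constant T lam kappa * mesh L N ^ 4"
      "cmod (wbar 0 T - E T * mean_exp z) \<le> error_constant T lam kappa * mesh L N ^ 4"
    using err init[of 0] by simp_all
  show "\<forall>j\<in>{0..int N}. cmod (w j T - wstar (node L N j) T) \<le> error_constant T lam kappa * mesh L N ^ 4"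
  proof
    fix j assume j: "j \<in> {0..int N}"
    have "w j T - wstar (node L N j) T = exp (of_int j * z) * (w 0 T - E T)"
      using mode(1)[OF T0(2), of j] nodal[OF j T0(2)] by (simp add: algebra_simps)
    then show "cmod (w j T - wstar (node L N j) T) \<le> error_constant T lam kappa * mesh L N ^ 4"
      using err(1) by (simp only: norm_mult norm_mode mult_1)
  qed
  show "\<forall>j\<in>{0..<int N}. cmod (wbar j T - cell_average L N j (\<lambda>x. wstar x T))
           \<le> error_constant T lam kappa * mesh L N ^ 4"
  proof
    fix j assume j: "j \<in> {0..<int N}"
    have "wbar j T - cell_average L N j (\<lambda>x. wstar x T)
        = exp (of_int j * z) * (wbar 0 T - E T * mean_exp z)"
      using mode(2)[OF T0(2), of j] average[OF j T0(2)] by (simp add: algebra_simps)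
    then show "cmod (wbar j T - cell_average L N j (\<lambda>x. wstar x T))
        \<le> error_constant T lam kappa * mesh L N ^ 4"
      using err(2) by (simp only: norm_mult norm_mode mult_1)
  qed
qed

theorem theorem3p1:
  fixes L T lam kappa :: real
  assumes "L > 0" and "T > 0" and "lam > 0"
    and "\<exists>m::int. kappa = 2 * of_int m * pi / L"
  shows "\<exists>C::real. \<forall>(N::nat) (wstar :: real \<Rightarrow> real \<Rightarrow> complex)
             (w :: int \<Rightarrow> real \<Rightarrow> complex) (wbar :: int \<Rightarrow> real \<Rightarrow> complex).
           N > 0 \<longrightarrow>
           periodic_advection_solution L T lam (\<lambda>x. exp (\<i> * of_real (kappa * x))) wstar \<longrightarrow>
           hybrid_variable_solution L T lam N w wbar \<longrightarrow>
           exact_initial_data L N wstar w wbar \<longrightarrow>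
           (\<forall>j\<in>{0..int N}. cmod (w j T - wstar (node L N j) T) \<le> C * mesh L N ^ 4) \<and>
           (\<forall>j\<in>{0..<int N}.
              cmod (wbar j T - cell_average L N j (\<lambda>x. wstar x T)) \<le> C * mesh L N ^ 4)"
proof -
  obtain m :: int where kappa: "kappa = 2 * of_int m * pi / L" using assms(4) by blast
  show ?thesis
    by (intro exI[of _ "error_constant T lam kappa"] allI impI conjI
          hybrid_variable_wave_error[OF assms(1-3) kappa])
qed

end
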